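(* Let $\gamma>0$, let $n\ge 1$ and let $X_1,\dots,X_n$ be i.i.d. random variables with the $\Gamma(\gamma)$ distribution. Let $\Phi\colon(0,+\infty)\to(0,+\infty)$ be a completely monotone function. Then the function $$(a_1,\dots,a_n)\mapsto \mathbb{E}\,\Phi\left(\sum_{j=1}^n\sqrt{a_j}\,X_j\right)\in(0,+\infty]$$ is Schur-convex on $\mathbb{R}_+^n$.
   Context: The $\Gamma(\gamma)$ distribution is the distribution on $\mathbb{R}$ with density $\Gamma(\gamma)^{-1}x^{\gamma-1}e^{-x}\mathbf{1}_{(0,\infty)}(x)$. A function $\Phi\colon(0,+\infty)\to(0,+\infty)$ is completely monotone if $\Phi(x)=\int_0^\infty e^{-tx}\,\mathrm{d}\mu(t)$ for all $x>0$, for some nonnegative Borel measure $\mu$ on $[0,\infty)$; equivalently, $(-1)^m\Phi^{(m)}(x)\ge 0$ for all $x>0$ and $m=0,1,2,\dots$. Here $\mathbb{R}_+=[0,\infty)$, the expectation may equal $+\infty$, and at $a=0$ one uses the convention $\Phi(0)=\lim_{x\to0+}\Phi(x)\in(0,+\infty]$. A vector $a\in\mathbb{R}^n$ is majorised by $b\in\mathbb{R}^n$ if $\sum_j a_j=\sum_j b_j$ and, for each $k\le n$, the sum of the $k$ largest coordinates of $a$ is at most the sum of the $k$ largest coordinates of $b$. A function $F$ (possibly with value $+\infty$) is Schur-convex on a permutation-invariant set $D$ if $F(a)\le F(b)$ whenever $a,b\in D$ and $a$ is majorised by $b$. *)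

theory Defs
  imports "HOL-Probability.Probability"
begin

definition gamma_density :: "real \<Rightarrow> real \<Rightarrow> real" where
  "gamma_density \<gamma> x = (if 0 < x then x powr (\<gamma> - 1) * exp (- x) / Gamma \<gamma> else 0)"

text \<open>
  Only the values of \<open>\<Phi>\<close> on the open half-line \<open>{0<..}\<close> matter. Since \<open>ennreal (\<Phi> x)\<close> is
  finite, the defining equation also says that the integral converges for every \<open>x > 0\<close>;
  the measure \<open>\<mu>\<close> itself need not be finite.
\<close>

definition completely_monotone :: "(real \<Rightarrow> real) \<Rightarrow> bool" where
  "completely_monotone \<Phi> \<longleftrightarrow>
     (\<forall>x>0. 0 < \<Phi> x) \<and>
     (\<exists>\<mu> :: real measure. sets \<mu> = sets (restrict_space borel {0..}) \<and>
        (\<forall>x>0. ennreal (\<Phi> x) = (\<integral>\<^sup>+ t. ennreal (exp (- t * x)) \<partial>\<mu>)))"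

text \<open>
  The value at \<open>0\<close> is the right-hand limit of \<open>\<Phi>\<close>, possibly \<open>\<infinity>\<close>. The value at negative
  arguments is a dummy: below, such arguments occur only with probability zero.
\<close>

definition extend_at_zero :: "(real \<Rightarrow> real) \<Rightarrow> real \<Rightarrow> ennreal" where
  "extend_at_zero \<Phi> x =
     (if 0 < x then ennreal (\<Phi> x) else Lim (at_right 0) (\<lambda>y. ennreal (\<Phi> y)))"

definition decreasing_rearrangement :: "real ^ 'n::finite \<Rightarrow> real list" where
  "decreasing_rearrangement a =
     rev (sorted_list_of_multiset (image_mset (\<lambda>i. a $ i) (mset_set UNIV)))"

definition sum_largest :: "nat \<Rightarrow> real ^ 'n::finite \<Rightarrow> real" where
  "sum_largest k a = sum_list (take k (decreasing_rearrangement a))"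

definition majorised_by :: "real ^ 'n::finite \<Rightarrow> real ^ 'n \<Rightarrow> bool" where
  "majorised_by a b \<longleftrightarrow>
     (\<Sum>j\<in>UNIV. a $ j) = (\<Sum>j\<in>UNIV. b $ j) \<and>
     (\<forall>k\<le>CARD('n). sum_largest k a \<le> sum_largest k b)"

definition permutation_invariant :: "(real ^ 'n::finite) set \<Rightarrow> bool" where
  "permutation_invariant D \<longleftrightarrow>
     (\<forall>p a. bij p \<longrightarrow> a \<in> D \<longrightarrow> (\<chi> i. a $ p i) \<in> D)"

definition schur_convex_on :: "(real ^ 'n::finite) set \<Rightarrow> (real ^ 'n \<Rightarrow> ennreal) \<Rightarrow> bool" where
  "schur_convex_on D F \<longleftrightarrow>
     permutation_invariant D \<and>
     (\<forall>a\<in>D. \<forall>b\<in>D. majorised_by a b \<longrightarrow> F a \<le> F b)"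

end

theory Submission
  imports Defs
begin

text \<open>
  The square roots are what makes the map Schur-convex. A completely monotone \<open>\<Phi>\<close> is a
  mixture of the exponentials \<open>x \<mapsto> exp (- t x)\<close>, and for one exponential independence and the
  Laplace transform \<open>(1 + s) powr - \<gamma>\<close> of the gamma law give
  \<open>E exp (- t (\<Sum>j. sqrt (a $ j) * X j)) = (\<Prod>j. (1 + t * sqrt (a $ j)) powr - \<gamma>)
    = exp (\<gamma> * (\<Sum>j. - ln (1 + t * sqrt (a $ j))))\<close>.
  For each \<open>t \<ge> 0\<close> the function \<open>x \<mapsto> - ln (1 + t * sqrt x)\<close> is convex on the half-line, so
  Karamata's inequality makes the inner sum, and with it the product, Schur-convex in \<open>a\<close>.
  Integrating over the mixing measure \<open>\<mu>\<close> preserves this inequality.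

  Two points need care. Exchanging the expectation with the integral over \<open>\<mu>\<close> uses Tonelli's
  theorem, hence that \<open>\<mu>\<close> is \<open>\<sigma>\<close>-finite; this holds because \<open>t \<mapsto> exp (- t)\<close> is a strictly
  positive function with finite integral \<open>\<Phi> 1\<close>. The sum of the \<open>sqrt (a $ j) * X j\<close> vanishes for
  \<open>a = 0\<close>, where \<open>\<Phi>\<close> is continued by its limit; by monotone convergence this limit is the
  total mass of \<open>\<mu>\<close>, which is the value of the Laplace integral at \<open>0\<close>.
\<close>

section \<open>Karamata's inequality\<close>

lemma convex_on_slope_mono:
  fixes g :: "real \<Rightarrow> real"
  assumes g: "convex_on S g" and S: "x \<in> S" "v \<in> S" "w \<in> S"
    and ne: "v \<noteq> x" "w \<noteq> x" and le: "v \<le> w"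
  shows "(g v - g x) / (v - x) \<le> (g w - g x) / (w - x)"
proof (cases "v = w")
  case False
  with le have "v < w" by simp
  consider "x < v" | "v < x" "x < w" | "w < x" using ne \<open>v < w\<close> by linarith
  then show ?thesis
  proof cases
    case 1
    then show ?thesis
      using convex_on_slope_le(1)[OF g S(1,3) 1 \<open>v < w\<close>]
      by (simp add: minus_divide_divide[symmetric, of "g x - g v"] minus_divide_divide[symmetric, of "g x - g w"])
  next
    case 2
    then show ?thesis
      using order_trans[OF convex_on_slope_le[OF g S(2,3) 2]]
      by (simp add: minus_divide_divide[symmetric, of "g x - g w"])
  next
    case 3
    then show ?thesis
      using convex_on_slope_le(2)[OF g S(2,1) \<open>v < w\<close> 3] by simp
  qed
qed simp

text \<open>
  Moving both endpoints of a chord to the left does not increase its slope: move them one at a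
  time. The intermediate chord from \<open>x'\<close> to \<open>y\<close> degenerates when \<open>x' = y\<close>, but then the two
  given chords are adjacent.
\<close>

lemma convex_on_chord_slope_mono:
  fixes g :: "real \<Rightarrow> real"
  assumes g: "convex_on S g" and S: "x \<in> S" "y \<in> S" "x' \<in> S" "y' \<in> S"
    and ne: "x \<noteq> y" "x' \<noteq> y'" and le: "x' \<le> x" "y' \<le> y"
  shows "(g y' - g x') / (y' - x') \<le> (g y - g x) / (y - x)"
proof (cases "x' = y")
  case True
  have "(g y' - g x') / (y' - x') \<le> (g x - g x') / (x - x')"
    by (rule convex_on_slope_mono[OF g]) (use S ne le True in auto)
  then show ?thesis
    using True minus_divide_divide[of "g y - g x" "y - x"] by simp
next
  case False
  have "(g y' - g x') / (y' - x') \<le> (g y - g x') / (y - x')"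
    by (rule convex_on_slope_mono[OF g]) (use S ne le False in auto)
  also have "\<dots> = (g x' - g y) / (x' - y)"
    using minus_divide_divide[of "g y - g x'" "y - x'"] by simp
  also have "\<dots> \<le> (g x - g y) / (x - y)"
    by (rule convex_on_slope_mono[OF g]) (use S ne le False in auto)
  also have "\<dots> = (g y - g x) / (y - x)"
    using minus_divide_divide[of "g y - g x" "y - x"] by simp
  finally show ?thesis .
qed

text \<open>
  This is Abel summation in disguise. Along the decreasing sequences the chord slopes of \<open>g\<close>
  decrease, so the last nontrivial slope \<open>s\<close> bounds all earlier ones from below and the
  induction hypothesis may be used with \<open>s\<close>. Passing from \<open>s\<close> to the smaller \<open>c\<close> is allowed
  because the sum it multiplies is nonnegative by the domination of partial sums. The
  arbitrary lower bound \<open>c\<close> is what lets the induction go through; working with chords instead of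
  derivatives allows \<open>g\<close> to have infinite slope at an endpoint of \<open>S\<close>, as the function
  \<open>x \<mapsto> - ln (1 + t * sqrt x)\<close> does at \<open>0\<close> for \<open>t > 0\<close>.
\<close>

lemma convex_on_sum_diff_ge:
  fixes g :: "real \<Rightarrow> real" and x y :: "nat \<Rightarrow> real"
  assumes g: "convex_on S g"
    and S: "\<And>i. i < n \<Longrightarrow> x i \<in> S" "\<And>i. i < n \<Longrightarrow> y i \<in> S"
    and decr: "\<And>i j. i \<le> j \<Longrightarrow> j < n \<Longrightarrow> x j \<le> x i" "\<And>i j. i \<le> j \<Longrightarrow> j < n \<Longrightarrow> y j \<le> y i"
    and dom: "\<And>k. k \<le> n \<Longrightarrow> (\<Sum>i<k. x i) \<le> (\<Sum>i<k. y i)"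
    and c: "\<And>i. i < n \<Longrightarrow> x i \<noteq> y i \<Longrightarrow> c \<le> (g (y i) - g (x i)) / (y i - x i)"
  shows "c * (\<Sum>i<n. y i - x i) \<le> (\<Sum>i<n. g (y i) - g (x i))"
  using assms
proof (induction n arbitrary: c)
  case (Suc n c)
  have IH: "d * (\<Sum>i<n. y i - x i) \<le> (\<Sum>i<n. g (y i) - g (x i))"
    if "\<And>i. i < n \<Longrightarrow> x i \<noteq> y i \<Longrightarrow> d \<le> (g (y i) - g (x i)) / (y i - x i)" for d
    by (rule Suc.IH) (use Suc.prems that in auto)
  show ?case
  proof (cases "x n = y n")
    case True
    then show ?thesis using IH[of c] Suc.prems(7) by auto
  next
    case False
    define s where "s = (g (y n) - g (x n)) / (y n - x n)"
    have "s \<le> (g (y i) - g (x i)) / (y i - x i)" if "i < n" "x i \<noteq> y i" for i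
      unfolding s_def
      by (rule convex_on_chord_slope_mono[OF g])
         (use that False Suc.prems(2,3) Suc.prems(4,5)[of i n] in auto)
    then have 1: "s * (\<Sum>i<n. y i - x i) \<le> (\<Sum>i<n. g (y i) - g (x i))"
      by (rule IH)
    have 2: "s * (y n - x n) = g (y n) - g (x n)"
      using False by (simp add: s_def)
    have "0 \<le> (\<Sum>i<Suc n. y i - x i)"
      using Suc.prems(6)[of "Suc n"] by (simp add: sum_subtractf)
    moreover have "c \<le> s"
      using Suc.prems(7)[of n] False by (simp add: s_def)
    ultimately have "c * (\<Sum>i<Suc n. y i - x i) \<le> s * (\<Sum>i<Suc n. y i - x i)"
      by (rule mult_right_mono[rotated])
    also have "\<dots> \<le> (\<Sum>i<Suc n. g (y i) - g (x i))"
      using 1 2 by (simp add: distrib_left)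
    finally show ?thesis .
  qed
qed simp

lemma karamata_nat:
  fixes g :: "real \<Rightarrow> real" and x y :: "nat \<Rightarrow> real"
  assumes g: "convex_on S g"
    and S: "\<And>i. i < n \<Longrightarrow> x i \<in> S" "\<And>i. i < n \<Longrightarrow> y i \<in> S"
    and decr: "\<And>i j. i \<le> j \<Longrightarrow> j < n \<Longrightarrow> x j \<le> x i" "\<And>i j. i \<le> j \<Longrightarrow> j < n \<Longrightarrow> y j \<le> y i"
    and dom: "\<And>k. k \<le> n \<Longrightarrow> (\<Sum>i<k. x i) \<le> (\<Sum>i<k. y i)"
    and total: "(\<Sum>i<n. x i) = (\<Sum>i<n. y i)"
  shows "(\<Sum>i<n. g (x i)) \<le> (\<Sum>i<n. g (y i))"
proof -
  \<comment> \<open>Any lower bound of the finitely many slopes will do, since it multiplies a vanishing sum;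
      the \<open>0\<close> only keeps the set nonempty.\<close>
  define c where "c = Min (insert 0 ((\<lambda>i. (g (y i) - g (x i)) / (y i - x i)) ` {..<n}))"
  have "c * (\<Sum>i<n. y i - x i) \<le> (\<Sum>i<n. g (y i) - g (x i))"
    by (rule convex_on_sum_diff_ge[OF g]) (use S decr dom in \<open>auto simp: c_def intro!: Min_le\<close>)
  then show ?thesis using total by (simp add: sum_subtractf)
qed

text \<open>
  These facts turn statements about vectors and their \<open>sum_largest\<close> into statements about
  decreasing sequences indexed by \<open>{..<CARD('n)}\<close>.
\<close>

lemma
  fixes a :: "real ^ 'n::finite"
  shows length_decreasing_rearrangement: "length (decreasing_rearrangement a) = CARD('n)"
    and set_decreasing_rearrangement: "set (decreasing_rearrangement a) = range (($) a)"
    and decreasing_rearrangement_nth_mono: "i \<le> j \<Longrightarrow> j < CARD('n) \<Longrightarrow>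
          decreasing_rearrangement a ! j \<le> decreasing_rearrangement a ! i"
    and sum_decreasing_rearrangement: "(\<Sum>i<CARD('n). g (decreasing_rearrangement a ! i)) = (\<Sum>j\<in>UNIV. g (a $ j) :: real)"
    and sum_largest_eq_sum: "k \<le> CARD('n) \<Longrightarrow> sum_largest k a = (\<Sum>i<k. decreasing_rearrangement a ! i)"
proof -
  let ?L = "decreasing_rearrangement a"
  have m: "mset ?L = image_mset (($) a) (mset_set UNIV)"
    by (simp add: decreasing_rearrangement_def)
  show len: "length ?L = CARD('n)"
    using arg_cong[OF m, of size] by simp
  show "set ?L = range (($) a)"
    using arg_cong[OF m, of set_mset] by simp
  show "i \<le> j \<Longrightarrow> j < CARD('n) \<Longrightarrow> ?L ! j \<le> ?L ! i"
    using sorted_rev_nth_mono[of ?L i j] len by (simp add: decreasing_rearrangement_def)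
  have "(\<Sum>j\<in>UNIV. g (a $ j)) = sum_mset (image_mset g (mset ?L))"
    by (simp add: m sum_unfold_sum_mset image_mset.compositionality comp_def)
  also have "\<dots> = sum_list (map g ?L)"
    by (simp flip: sum_mset_sum_list)
  also have "\<dots> = (\<Sum>i<CARD('n). g (?L ! i))"
    by (simp add: sum_list_sum_nth len atLeast0LessThan)
  finally show "(\<Sum>i<CARD('n). g (?L ! i)) = (\<Sum>j\<in>UNIV. g (a $ j))" ..
  show "sum_largest k a = (\<Sum>i<k. ?L ! i)" if "k \<le> CARD('n)"
    using that by (simp add: sum_largest_def sum_list_sum_nth len atLeast0LessThan min_absorb2)
qed

theorem karamata:
  fixes a b :: "real ^ 'n::finite" and g :: "real \<Rightarrow> real"
  assumes g: "convex_on S g" and S: "\<And>j. a $ j \<in> S" "\<And>j. b $ j \<in> S" and ab: "majorised_by a b"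
  shows "(\<Sum>j\<in>UNIV. g (a $ j)) \<le> (\<Sum>j\<in>UNIV. g (b $ j))"
proof -
  have mem: "decreasing_rearrangement a ! i \<in> S" "decreasing_rearrangement b ! i \<in> S"
    if "i < CARD('n)" for i
    using nth_mem[of i "decreasing_rearrangement a"] nth_mem[of i "decreasing_rearrangement b"] that S
    by (auto simp: set_decreasing_rearrangement length_decreasing_rearrangement)
  show ?thesis
    unfolding sum_decreasing_rearrangement[symmetric]
    by (rule karamata_nat[OF g])
       (use ab sum_decreasing_rearrangement[of "\<lambda>x. x" a] sum_decreasing_rearrangement[of "\<lambda>x. x" b] in
         \<open>auto simp: mem decreasing_rearrangement_nth_mono majorised_by_def sum_largest_eq_sum\<close>)
qed

section \<open>Schur-convexity of the product of Laplace transforms\<close>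

text \<open>
  The function \<open>- ln (1 + t * s)\<close> is convex and decreasing in \<open>s\<close>, and \<open>s = sqrt x\<close> is concave
  in \<open>x\<close>.
\<close>

lemma convex_on_minus_ln_one_plus_sqrt:
  fixes t :: real
  assumes t: "0 \<le> t"
  shows "convex_on {0..} (\<lambda>x. - ln (1 + t * sqrt x))"
proof (rule convex_onI)
  fix u x y :: real
  assume u: "0 < u" "u < 1" and xy: "x \<in> {0..}" "y \<in> {0..}"
  let ?p = "1 + t * sqrt x" and ?q = "1 + t * sqrt y"
  have pos: "0 < ?p" "0 < ?q" using t xy by (auto intro!: add_pos_nonneg)
  \<comment> \<open>Concavity of the square root: the two squared sides differ by a multiple of
      \<open>(sqrt x - sqrt y)\<^sup>2\<close>.\<close>
  have sqrt: "(1 - u) * sqrt x + u * sqrt y \<le> sqrt ((1 - u) * x + u * y)"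
  proof (rule real_le_rsqrt)
    have "(1 - u) * x + u * y - ((1 - u) * sqrt x + u * sqrt y)\<^sup>2 = (1 - u) * u * (sqrt x - sqrt y)\<^sup>2"
    proof -
      have "x = (sqrt x)\<^sup>2" "y = (sqrt y)\<^sup>2" using xy by auto
      then have "(1 - u) * x + u * y = (1 - u) * (sqrt x)\<^sup>2 + u * (sqrt y)\<^sup>2" by metis
      then show ?thesis by (simp add: power2_eq_square algebra_simps)
    qed
    moreover have "0 \<le> (1 - u) * u * (sqrt x - sqrt y)\<^sup>2" using u by simp
    ultimately show "((1 - u) * sqrt x + u * sqrt y)\<^sup>2 \<le> (1 - u) * x + u * y" by linarith
  qed
  have "(1 - u) * ln ?p + u * ln ?q \<le> ln ((1 - u) * ?p + u * ?q)"
    using concave_onD[OF ln_concave, of u ?p ?q] u pos by simp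
  also have "\<dots> \<le> ln (1 + t * sqrt ((1 - u) * x + u * y))"
  proof (rule ln_mono)
    show "0 < (1 - u) * ?p + u * ?q" using u pos by (simp add: add_pos_pos)
    have "t * ((1 - u) * sqrt x + u * sqrt y) \<le> t * sqrt ((1 - u) * x + u * y)"
      using sqrt t by (rule mult_left_mono)
    then show "(1 - u) * ?p + u * ?q \<le> 1 + t * sqrt ((1 - u) * x + u * y)"
      by (simp add: algebra_simps)
  qed
  finally show "- ln (1 + t * sqrt ((1 - u) *\<^sub>R x + u *\<^sub>R y)) \<le> (1 - u) * - ln ?p + u * - ln ?q"
    by simp
qed simp

lemma prod_one_plus_sqrt_powr_mono:
  fixes a b :: "real ^ 'n::finite" and \<gamma> t :: real
  assumes "0 \<le> \<gamma>" and t: "0 \<le> t" and a: "\<And>j. 0 \<le> a $ j" and b: "\<And>j. 0 \<le> b $ j"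
    and ab: "majorised_by a b"
  shows "(\<Prod>j\<in>UNIV. (1 + t * sqrt (a $ j)) powr - \<gamma>) \<le> (\<Prod>j\<in>UNIV. (1 + t * sqrt (b $ j)) powr - \<gamma>)"
proof -
  have eq: "(\<Prod>j\<in>UNIV. (1 + t * sqrt (c $ j)) powr - \<gamma>) = exp (\<gamma> * (\<Sum>j\<in>UNIV. - ln (1 + t * sqrt (c $ j))))"
    if "\<And>j. 0 \<le> c $ j" for c :: "real ^ 'n"
  proof -
    have "1 + t * sqrt (c $ j) \<noteq> 0" for j
      using t that[of j] by (smt (verit) mult_nonneg_nonneg real_sqrt_ge_zero)
    then show ?thesis by (simp add: sum_distrib_left exp_sum powr_def flip: sum_negf)
  qed
  have "(\<Sum>j\<in>UNIV. - ln (1 + t * sqrt (a $ j))) \<le> (\<Sum>j\<in>UNIV. - ln (1 + t * sqrt (b $ j)))"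
    by (rule karamata[OF convex_on_minus_ln_one_plus_sqrt[OF t] _ _ ab]) (use a b in auto)
  then show ?thesis
    unfolding eq[OF a] eq[OF b] using \<open>0 \<le> \<gamma>\<close> by (simp add: mult_left_mono del: sum_negf)
qed

section \<open>Laplace transforms of gamma variables\<close>

lemma borel_measurable_gamma_density [measurable]: "gamma_density \<gamma> \<in> borel_measurable borel"
  unfolding gamma_density_def[abs_def] by measurable

lemma gamma_density_nonneg: "0 < \<gamma> \<Longrightarrow> 0 \<le> gamma_density \<gamma> x"
  by (simp add: gamma_density_def Gamma_real_pos less_imp_le)

text \<open>Substituting \<open>u = (1 + s) * x\<close> reduces the integral to Euler's integral for \<open>Gamma \<gamma>\<close>.\<close>

lemma gamma_density_laplace:
  assumes \<gamma>: "0 < \<gamma>" and s: "0 \<le> s"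
  shows "(\<integral>\<^sup>+ x. ennreal (gamma_density \<gamma> x) * ennreal (exp (- (s * x))) \<partial>lborel) = ennreal ((1 + s) powr - \<gamma>)"
proof -
  let ?h = "\<lambda>u::real. ennreal (indicator {0..} u * u powr (\<gamma> - 1) / exp u)"
  have G: "0 < Gamma \<gamma>" using \<gamma> by (rule Gamma_real_pos)
  have eq: "gamma_density \<gamma> x * exp (- (s * x))
      = (1 + s) powr (1 - \<gamma>) / Gamma \<gamma> * (indicator {0..} ((1 + s) * x) * ((1 + s) * x) powr (\<gamma> - 1) / exp ((1 + s) * x))" for x
  proof (cases "0 < x")
    case True
    then have "indicator {0..} ((1 + s) * x) = (1::real)" using s by simp
    moreover have "((1 + s) * x) powr (\<gamma> - 1) = (1 + s) powr (\<gamma> - 1) * x powr (\<gamma> - 1)"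
      using s True by (simp add: powr_mult)
    moreover have "(1 + s) powr (1 - \<gamma>) * (1 + s) powr (\<gamma> - 1) = 1"
      using s by (simp flip: powr_add)
    moreover have "exp (- x) * exp (- (s * x)) = 1 / exp ((1 + s) * x)"
      by (simp add: exp_minus exp_add distrib_right field_simps)
    moreover have "gamma_density \<gamma> x * exp (- (s * x)) = x powr (\<gamma> - 1) * (exp (- x) * exp (- (s * x))) / Gamma \<gamma>"
      using True by (simp add: gamma_density_def)
    ultimately show ?thesis by (simp flip: mult.assoc)
  next
    case False
    then have "indicator {0..} ((1 + s) * x) = (0::real) \<or> x = 0"
      using s by (auto simp: indicator_def zero_le_mult_iff)
    then show ?thesis using False by (auto simp: gamma_density_def)
  qed
  have "(\<integral>\<^sup>+ x. ennreal (gamma_density \<gamma> x) * ennreal (exp (- (s * x))) \<partial>lborel)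
      = (\<integral>\<^sup>+ x. ennreal ((1 + s) powr (1 - \<gamma>) / Gamma \<gamma>) * ?h (0 + (1 + s) * x) \<partial>lborel)"
    using G by (intro nn_integral_cong)
      (simp add: gamma_density_nonneg[OF \<gamma>] eq flip: ennreal_mult')
  also have "\<dots> = ennreal ((1 + s) powr (1 - \<gamma>) / Gamma \<gamma>) * (\<integral>\<^sup>+ x. ?h (0 + (1 + s) * x) \<partial>lborel)"
    by (rule nn_integral_cmult) measurable
  also have "(\<integral>\<^sup>+ x. ?h (0 + (1 + s) * x) \<partial>lborel) = ennreal (Gamma \<gamma> / (1 + s))"
  proof -
    have "ennreal (Gamma \<gamma>) = (\<integral>\<^sup>+ u. ?h u \<partial>lborel)"
      using \<gamma> by (rule Gamma_conv_nn_integral_real)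
    also have "\<dots> = ennreal (1 + s) * (\<integral>\<^sup>+ x. ?h (0 + (1 + s) * x) \<partial>lborel)"
      using s by (subst nn_integral_real_affine[where c = "1 + s" and t = 0]) auto
    finally have "ennreal (1 / (1 + s)) * ennreal (Gamma \<gamma>)
        = ennreal (1 / (1 + s)) * (ennreal (1 + s) * (\<integral>\<^sup>+ x. ?h (0 + (1 + s) * x) \<partial>lborel))"
      by simp
    also have "\<dots> = (\<integral>\<^sup>+ x. ?h (0 + (1 + s) * x) \<partial>lborel)"
      using s by (subst mult.assoc[symmetric], subst ennreal_mult'[symmetric]) auto
    finally show ?thesis using s G by (simp flip: ennreal_mult')
  qed
  also have "ennreal ((1 + s) powr (1 - \<gamma>) / Gamma \<gamma>) * ennreal (Gamma \<gamma> / (1 + s)) = ennreal ((1 + s) powr - \<gamma>)"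
  proof -
    have "(1 + s) powr (1 - \<gamma>) = (1 + s) powr - \<gamma> * (1 + s)"
      using s powr_add[of "1 + s" "- \<gamma>" 1] by simp
    then show ?thesis using G s by (subst ennreal_mult'[symmetric]) auto
  qed
  finally show ?thesis .
qed

lemma (in prob_space) gamma_sum_laplace:
  fixes X :: "'n::finite \<Rightarrow> 'a \<Rightarrow> real"
  assumes \<gamma>: "0 < \<gamma>" and indep: "indep_vars (\<lambda>_. borel) X UNIV"
    and X: "\<And>j. distributed M lborel (X j) (\<lambda>x. ennreal (gamma_density \<gamma> x))"
    and c: "\<And>j. 0 \<le> c j" and t: "0 \<le> t"
  shows "(\<integral>\<^sup>+ \<omega>. ennreal (exp (- (t * (\<Sum>j\<in>UNIV. c j * X j \<omega>)))) \<partial>M) = ennreal (\<Prod>j\<in>UNIV. (1 + t * c j) powr - \<gamma>)"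
proof -
  have "(\<integral>\<^sup>+ \<omega>. ennreal (exp (- (t * (\<Sum>j\<in>UNIV. c j * X j \<omega>)))) \<partial>M)
      = (\<integral>\<^sup>+ \<omega>. (\<Prod>j\<in>UNIV. ennreal (exp (- (t * c j * X j \<omega>)))) \<partial>M)"
    by (simp add: sum_distrib_left exp_sum prod_ennreal mult.assoc flip: sum_negf)
  also have "\<dots> = (\<Prod>j\<in>UNIV. \<integral>\<^sup>+ \<omega>. ennreal (exp (- (t * c j * X j \<omega>))) \<partial>M)"
    by (intro indep_vars_nn_integral indep_vars_compose2[OF indep]) auto
  also have "\<dots> = (\<Prod>j\<in>UNIV. ennreal ((1 + t * c j) powr - \<gamma>))"
  proof (rule prod.cong[OF refl])
    fix j
    have "(\<integral>\<^sup>+ \<omega>. ennreal (exp (- (t * c j * X j \<omega>))) \<partial>M)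
        = (\<integral>\<^sup>+ x. ennreal (gamma_density \<gamma> x) * ennreal (exp (- (t * c j * x))) \<partial>lborel)"
      by (rule distributed_nn_integral[OF X, symmetric]) measurable
    also have "\<dots> = ennreal ((1 + t * c j) powr - \<gamma>)"
      using \<gamma> t c by (intro gamma_density_laplace) auto
    finally show "(\<integral>\<^sup>+ \<omega>. ennreal (exp (- (t * c j * X j \<omega>))) \<partial>M) = ennreal ((1 + t * c j) powr - \<gamma>)" .
  qed
  also have "\<dots> = ennreal (\<Prod>j\<in>UNIV. (1 + t * c j) powr - \<gamma>)"
    by (simp add: prod_ennreal)
  finally show ?thesis .
qed

lemma AE_gamma_pos:
  assumes "distributed M lborel Y (\<lambda>x. ennreal (gamma_density \<gamma> x))"
  shows "AE \<omega> in M. 0 < Y \<omega>"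
proof -
  have "AE x in distr M lborel Y. 0 < x"
    unfolding distributed_distr_eq_density[OF assms]
    by (subst AE_density) (auto simp: gamma_density_def)
  then show ?thesis
    by (rule AE_distrD[OF distributed_measurable[OF assms]])
qed

section \<open>The mixing measure of a completely monotone function\<close>

text \<open>
  By Markov's inequality each of the sets where \<open>f \<ge> 1 / n\<close> has finite measure, and these sets
  exhaust the space.
\<close>

lemma sigma_finite_measureI_nn_integral:
  fixes f :: "'a \<Rightarrow> real"
  assumes f[measurable]: "f \<in> borel_measurable \<mu>" and pos: "\<And>x. x \<in> space \<mu> \<Longrightarrow> 0 < f x"
    and fin: "(\<integral>\<^sup>+ x. ennreal (f x) \<partial>\<mu>) < \<infinity>"
  shows "sigma_finite_measure \<mu>"
proof
  let ?A = "\<lambda>n::nat. {x \<in> space \<mu>. 1 \<le> ennreal (real n) * ennreal (f x)}"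
  have "x \<in> (\<Union>n. ?A n)" if "x \<in> space \<mu>" for x
  proof -
    obtain n :: nat where "1 / f x \<le> real n" using real_arch_simple by blast
    then have "1 \<le> real n * f x" using pos[OF that] by (simp add: field_simps)
    then have "1 \<le> ennreal (real n) * ennreal (f x)"
      by (simp flip: ennreal_mult')
    then show ?thesis using that by auto
  qed
  moreover have "emeasure \<mu> (?A n) \<noteq> \<infinity>" for n
  proof -
    have "emeasure \<mu> (?A n) \<le> ennreal (real n) * (\<integral>\<^sup>+ x. ennreal (f x) * indicator (space \<mu>) x \<partial>\<mu>)"
      using nn_integral_Markov_inequality[where M = \<mu> and A = "space \<mu>" and u = "\<lambda>x. ennreal (f x)" and c = "ennreal (real n)"]
      by (simp add: Int_absorb2)
    also have "\<dots> = ennreal (real n) * (\<integral>\<^sup>+ x. ennreal (f x) \<partial>\<mu>)"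
      by (simp cong: nn_integral_cong)
    also have "\<dots> < \<infinity>" using fin by (simp add: ennreal_mult_less_top)
    finally show ?thesis by simp
  qed
  moreover have "?A n \<in> sets \<mu>" for n by measurable
  ultimately show "\<exists>A. countable A \<and> A \<subseteq> sets \<mu> \<and> \<Union> A = space \<mu> \<and> (\<forall>a\<in>A. emeasure \<mu> a \<noteq> \<infinity>)"
    by (intro exI[of _ "range ?A"]) auto
qed

text \<open>
  The Laplace transform decreases in \<open>x\<close>, so its right-hand limit at \<open>0\<close>, possibly infinite, is
  its supremum over the points \<open>1 / (n + 1)\<close>, to which monotone convergence applies.
\<close>

lemma laplace_transform_tendsto_at_right_0:
  fixes \<mu> :: "real measure"
  assumes [measurable]: "(\<lambda>t. t) \<in> borel_measurable \<mu>" and nonneg: "\<And>t. t \<in> space \<mu> \<Longrightarrow> 0 \<le> t"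
  shows "((\<lambda>x. \<integral>\<^sup>+ t. ennreal (exp (- (t * x))) \<partial>\<mu>) \<longlongrightarrow> emeasure \<mu> (space \<mu>)) (at_right 0)"
proof -
  let ?G = "\<lambda>x. \<integral>\<^sup>+ t. ennreal (exp (- (t * x))) \<partial>\<mu>"
  have anti: "?G y \<le> ?G x" if "x \<le> y" for x y
    by (intro nn_integral_mono ennreal_leI) (use nonneg that in \<open>simp add: mult_left_mono\<close>)
  have "(SUP n. ?G (1 / real (Suc n))) = (\<integral>\<^sup>+ t. (SUP n. ennreal (exp (- (t * (1 / real (Suc n)))))) \<partial>\<mu>)"
  proof (rule nn_integral_monotone_convergence_SUP_AE[symmetric])
    show "AE t in \<mu>. ennreal (exp (- (t * (1 / real (Suc n))))) \<le> ennreal (exp (- (t * (1 / real (Suc (Suc n))))))" for n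
      by (intro AE_I2 ennreal_leI) (use nonneg in \<open>auto intro!: divide_left_mono\<close>)
  qed measurable
  also have "\<dots> = (\<integral>\<^sup>+ t. 1 \<partial>\<mu>)"
  proof (rule nn_integral_cong)
    fix t assume t: "t \<in> space \<mu>"
    have "incseq (\<lambda>n. ennreal (exp (- (t * (1 / real (Suc n))))))"
      by (intro incseq_SucI ennreal_leI) (use nonneg[OF t] in \<open>auto intro!: divide_left_mono\<close>)
    moreover have "(\<lambda>n. ennreal (exp (- (t * (1 / real (Suc n)))))) \<longlonglongrightarrow> ennreal (exp (- (t * 0)))"
      using LIMSEQ_inverse_real_of_nat
      by (intro tendsto_ennrealI tendsto_intros) (simp add: inverse_eq_divide)
    ultimately show "(SUP n. ennreal (exp (- (t * (1 / real (Suc n)))))) = 1"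
      using LIMSEQ_SUP LIMSEQ_unique by fastforce
  qed
  finally have sup: "(SUP n. ?G (1 / real (Suc n))) = emeasure \<mu> (space \<mu>)" by simp
  show ?thesis
  proof (rule order_tendstoI)
    fix c assume "c < emeasure \<mu> (space \<mu>)"
    then obtain n where n: "c < ?G (1 / real (Suc n))"
      unfolding sup[symmetric] by (auto simp: less_SUP_iff)
    have "eventually (\<lambda>x::real. x < 1 / real (Suc n)) (at_right 0)"
      by (rule eventually_at_rightI[of 0 "1 / real (Suc n)"]) auto
    then show "eventually (\<lambda>x. c < ?G x) (at_right 0)"
      by eventually_elim (use n anti less_le_trans in \<open>meson less_imp_le\<close>)
  next
    fix c assume c: "emeasure \<mu> (space \<mu>) < c"
    have "?G x \<le> ?G 0" if "0 < x" for x using that by (intro anti) simp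
    then show "eventually (\<lambda>x. ?G x < c) (at_right 0)"
      using c by (auto simp: eventually_at_filter intro!: always_eventually intro: le_less_trans)
  qed
qed

lemma extend_at_zero_eq_laplace:
  fixes \<mu> :: "real measure"
  assumes m: "(\<lambda>t. t) \<in> borel_measurable \<mu>" and nonneg: "\<And>t. t \<in> space \<mu> \<Longrightarrow> 0 \<le> t"
    and \<Phi>: "\<And>x. 0 < x \<Longrightarrow> ennreal (\<Phi> x) = (\<integral>\<^sup>+ t. ennreal (exp (- (t * x))) \<partial>\<mu>)"
    and x: "0 \<le> x"
  shows "extend_at_zero \<Phi> x = (\<integral>\<^sup>+ t. ennreal (exp (- (t * x))) \<partial>\<mu>)"
proof (cases "x = 0")
  case True
  have "((\<lambda>y. ennreal (\<Phi> y)) \<longlongrightarrow> emeasure \<mu> (space \<mu>)) (at_right 0)"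
    using laplace_transform_tendsto_at_right_0[OF m nonneg]
    by (rule Lim_transform_eventually) (auto simp: \<Phi> eventually_at_filter intro!: always_eventually)
  then have "Lim (at_right 0) (\<lambda>y. ennreal (\<Phi> y)) = emeasure \<mu> (space \<mu>)"
    by (intro tendsto_Lim) auto
  then show ?thesis using True by (simp add: extend_at_zero_def)
next
  case False
  then show ?thesis using x \<Phi> by (simp add: extend_at_zero_def)
qed

section \<open>Schur-convexity of the expectation\<close>

theorem theorem2:
  fixes M :: "'a measure"
    and X :: "'n::finite \<Rightarrow> 'a \<Rightarrow> real"
    and \<gamma> :: real
    and \<Phi> :: "real \<Rightarrow> real"
    and F :: "real ^ 'n \<Rightarrow> ennreal"
  defines "F \<equiv> \<lambda>a. \<integral>\<^sup>+ \<omega>. extend_at_zero \<Phi> (\<Sum>j\<in>UNIV. sqrt (a $ j) * X j \<omega>) \<partial>M"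
  assumes "0 < \<gamma>"
    and "prob_space M"
    and "prob_space.indep_vars M (\<lambda>_. borel) X UNIV"
    and "\<And>j. distributed M lborel (X j) (\<lambda>x. ennreal (gamma_density \<gamma> x))"
    and "completely_monotone \<Phi>"
  shows "(\<forall>a\<in>{a. \<forall>j. 0 \<le> a $ j}. 0 < F a) \<and> schur_convex_on {a. \<forall>j. 0 \<le> a $ j} F"
proof -
  interpret M: prob_space M by fact
  note X = \<open>\<And>j. distributed M lborel (X j) (\<lambda>x. ennreal (gamma_density \<gamma> x))\<close>
  have [measurable]: "X j \<in> borel_measurable M" for j
    using distributed_measurable[OF X] by simp
  from \<open>completely_monotone \<Phi>\<close> obtain \<mu> :: "real measure"
    where sets: "sets \<mu> = sets (restrict_space borel {0..})"
      and \<Phi>_pos: "\<And>x. 0 < x \<Longrightarrow> 0 < \<Phi> x"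
      and \<Phi>: "\<And>x. 0 < x \<Longrightarrow> ennreal (\<Phi> x) = (\<integral>\<^sup>+ t. ennreal (exp (- (t * x))) \<partial>\<mu>)"
    unfolding completely_monotone_def by auto
  have nonneg: "0 \<le> t" if "t \<in> space \<mu>" for t
    using that sets_eq_imp_space_eq[OF sets] by (simp add: space_restrict_space)
  have id_meas[measurable]: "(\<lambda>t. t) \<in> borel_measurable \<mu>"
    unfolding measurable_cong_sets[OF sets refl] by (rule measurable_restrict_space1) simp
  interpret \<mu>: sigma_finite_measure \<mu>
  proof (rule sigma_finite_measureI_nn_integral)
    show "(\<integral>\<^sup>+ t. ennreal (exp (- t)) \<partial>\<mu>) < \<infinity>"
      using \<Phi>[of 1] ennreal_less_top[of "\<Phi> 1"] by simp
  qed auto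
  interpret P: pair_sigma_finite M \<mu> ..

  \<comment> \<open>The almost sure sign of the sum is needed because \<open>extend_at_zero\<close> agrees with the Laplace
      integral only at nonnegative arguments.\<close>
  have F_eq: "F a = (\<integral>\<^sup>+ t. ennreal (\<Prod>j\<in>UNIV. (1 + t * sqrt (a $ j)) powr - \<gamma>) \<partial>\<mu>)"
    if a: "\<And>j. 0 \<le> a $ j" for a
  proof -
    let ?S = "\<lambda>\<omega>. \<Sum>j\<in>UNIV. sqrt (a $ j) * X j \<omega>"
    have "AE \<omega> in M. \<forall>j\<in>UNIV. 0 < X j \<omega>"
      by (intro AE_finite_allI AE_gamma_pos[OF X]) simp
    then have "AE \<omega> in M. 0 \<le> ?S \<omega>"
      by eventually_elim (use a in \<open>auto intro!: sum_nonneg simp: less_imp_le\<close>)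
    then have "F a = (\<integral>\<^sup>+ \<omega>. (\<integral>\<^sup>+ t. ennreal (exp (- (t * ?S \<omega>))) \<partial>\<mu>) \<partial>M)"
      unfolding F_def
      by (intro nn_integral_cong_AE) (auto elim!: eventually_mono
           intro!: extend_at_zero_eq_laplace[OF id_meas nonneg \<Phi>])
    also have "\<dots> = (\<integral>\<^sup>+ t. (\<integral>\<^sup>+ \<omega>. ennreal (exp (- (t * ?S \<omega>))) \<partial>M) \<partial>\<mu>)"
      by (rule P.Fubini'[symmetric]) measurable
    also have "\<dots> = (\<integral>\<^sup>+ t. ennreal (\<Prod>j\<in>UNIV. (1 + t * sqrt (a $ j)) powr - \<gamma>) \<partial>\<mu>)"
      by (intro nn_integral_cong M.gamma_sum_laplace assms) (auto simp: a nonneg)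
    finally show ?thesis .
  qed

  \<comment> \<open>The integrand in \<open>F_eq\<close> is strictly positive, so its integral vanishes only if \<open>\<mu>\<close> is the
      null measure, which \<open>\<Phi> 1 > 0\<close> excludes.\<close>
  have "0 < F a" if a: "\<And>j. 0 \<le> a $ j" for a
  proof (rule ccontr)
    assume "\<not> 0 < F a"
    then have "AE t in \<mu>. ennreal (\<Prod>j\<in>UNIV. (1 + t * sqrt (a $ j)) powr - \<gamma>) = 0"
      unfolding F_eq[OF a] by (subst (asm) zero_less_iff_neq_zero) (simp add: nn_integral_0_iff_AE)
    moreover have "AE t in \<mu>. 0 < (\<Prod>j\<in>UNIV. (1 + t * sqrt (a $ j)) powr - \<gamma>)"
    proof (intro AE_I2 prod_pos ballI)
      fix t j assume "t \<in> space \<mu>"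
      then have "0 < 1 + t * sqrt (a $ j)" using nonneg a by (intro add_pos_nonneg) auto
      then show "0 < (1 + t * sqrt (a $ j)) powr - \<gamma>" by simp
    qed
    ultimately have "AE t in \<mu>. False"
      by eventually_elim (metis ennreal_eq_0_iff not_le)
    then have "(\<integral>\<^sup>+ t. ennreal (exp (- (t * 1))) \<partial>\<mu>) = (\<integral>\<^sup>+ t. 0 \<partial>\<mu>)"
      by (intro nn_integral_cong_AE) (auto elim: eventually_mono)
    then show False using \<Phi>[of 1] \<Phi>_pos[of 1] by simp
  qed
  moreover have "F a \<le> F b"
    if a: "\<And>j. 0 \<le> a $ j" and b: "\<And>j. 0 \<le> b $ j" and ab: "majorised_by a b" for a b
    unfolding F_eq[OF a] F_eq[OF b]
    by (intro nn_integral_mono ennreal_leI prod_one_plus_sqrt_powr_mono)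
       (use a b ab nonneg \<open>0 < \<gamma>\<close> in auto)
  ultimately show ?thesis
    by (auto simp: schur_convex_on_def permutation_invariant_def)
qed

end
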